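(* Let $n$ be a prime number and let $p = p(n)$ satisfy $1/2 \ge p \ge n^{-o(1)}$. Let $A_p$ be a $p$-random subset of $\mathbb{Z}_n$ and $\Gamma_p = \Gamma_{A_p}$ the random Cayley sum graph. Then $$\alpha(\Gamma_p) \ge \big(2 + o(1)\big)\log_{\frac{1}{1-p}} n$$ with high probability as $n \to \infty$.
   Context: For $A \subseteq \mathbb{Z}_n$, the Cayley sum graph $\Gamma_A$ has vertex set $\mathbb{Z}_n$ and an edge between distinct $x, y$ whenever $x + y \in A$. A $p$-random subset contains each element of $\mathbb{Z}_n$ independently with probability $p$. $\alpha$ denotes the independence number. "With high probability" means with probability tending to $1$ as $n \to \infty$. *)

theory Defs
  imports
    "HOL-Probability.Probability"
    "HOL-Number_Theory.Number_Theory"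
    "HOL-Library.Ramsey"
begin

text \<open>
  A graph is a pair of a vertex set and a set of two-element edges.  The predicate
  \<open>indep\<close> is the one of \<open>HOL-Library.Ramsey\<close>.
\<close>

definition independence_number :: "'a set \<times> 'a set set \<Rightarrow> nat" where
  "independence_number G = Max (card ` {S. S \<subseteq> fst G \<and> indep S (snd G)})"

definition Zmod :: "nat \<Rightarrow> int set" where
  "Zmod n = carrier (residue_ring (int n))"

definition cayley_sum_graph :: "nat \<Rightarrow> int set \<Rightarrow> int set \<times> int set set" where
  "cayley_sum_graph n A =
     (Zmod n,
      {{x, y} | x y. x \<in> Zmod n \<and> y \<in> Zmod n \<and> x \<noteq> y \<and> x \<oplus>\<^bsub>residue_ring (int n)\<^esub> y \<in> A})"

text \<open>
  The indicator function of the random set has independent Bernoulli values on \<open>Zmod n\<close>.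
  Note that \<open>bernoulli_pmf\<close> truncates its parameter to the unit interval.
\<close>

definition random_subset :: "nat \<Rightarrow> real \<Rightarrow> int set pmf" where
  "random_subset n p =
     map_pmf (\<lambda>f. {x \<in> Zmod n. f x}) (Pi_pmf (Zmod n) False (\<lambda>_. bernoulli_pmf p))"

definition primes_at_top :: "nat filter" where
  "primes_at_top = inf at_top (principal {n. prime n})"

end

theory Submission
  imports Defs "HOL-Real_Asymp.Real_Asymp"
begin

text \<open>
  The proof is a weighted second moment argument.  For an injective tuple
  \<open>f = (f\<^sub>1, \<dots>, f\<^sub>k)\<close> let \<open>X\<^sub>f\<close> be the set of sums \<open>f\<^sub>i + f\<^sub>j\<close> with \<open>i < j\<close>, and put \<open>q = 1 - p\<close>.
  Weighting the event \<open>X\<^sub>f \<inter> A = {}\<close> by the inverse \<open>1 / q ^ card X\<^sub>f\<close> of its probability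
  makes the sum \<open>W\<close> of all these weighted indicators have expectation equal to the number of tuples,
  and second moment equal to the sum of \<open>1 / q ^ card (X\<^sub>f \<inter> X\<^sub>g)\<close> over all pairs.

  For a fixed set \<open>Y\<close> the quantity \<open>2 * card (X\<^sub>f \<inter> Y)\<close> is at most the sum of the degrees of the graph
  on the indices in which \<open>u\<close> and \<open>v\<close> are adjacent iff \<open>f\<^sub>u + f\<^sub>v \<in> Y\<close>.  By the AM-GM inequality
  \<open>1 / q ^ card (X\<^sub>f \<inter> Y)\<close> is at most the average over \<open>v\<close> of \<open>B ^ deg v\<close> where \<open>B = (1/q) powr (k/2)\<close>.  Given
  \<open>f\<^sub>v\<close>, the degree of \<open>v\<close> is a sum of independent indicators of probability at most \<open>card Y / n\<close>, so the
  mean over all tuples is at most \<open>(1 + card Y * B / n) ^ k\<close>.  This tends to \<open>1\<close> as soon as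
  \<open>k ^ 3 * B / n\<close> tends to \<open>0\<close>, which is the case up to \<open>k = (2 - o(1)) log\<^bsub>1/q\<^esub> n\<close>.
\<close>

definition pair_sums :: "nat \<Rightarrow> nat \<Rightarrow> (nat \<Rightarrow> int) \<Rightarrow> int set" where
  "pair_sums n k f = (\<lambda>(i, j). (f i + f j) mod int n) ` {(i, j). i < j \<and> j < k}"

lemma finite_ordered_pairs: "finite {(i, j). i < j \<and> j < (k::nat)}"
  by (rule finite_subset[of _ "{..<k} \<times> {..<k}"]) auto

lemma finite_pair_sums: "finite (pair_sums n k f)"
  unfolding pair_sums_def by (intro finite_imageI finite_ordered_pairs)

lemma card_pair_sums_le: "card (pair_sums n k f) \<le> k\<^sup>2"
proof -
  have "card (pair_sums n k f) \<le> card {(i, j). i < j \<and> j < k}"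
    unfolding pair_sums_def by (intro card_image_le finite_ordered_pairs)
  also have "\<dots> \<le> card ({..<k} \<times> {..<k})"
    by (intro card_mono) auto
  finally show ?thesis
    by (simp add: power2_eq_square)
qed

lemma Zmod_eq: "Zmod n = {0..<int n}"
  by (auto simp: Zmod_def residue_ring_def)

lemma finite_Zmod: "finite (Zmod n)" and card_Zmod: "card (Zmod n) = n"
  by (simp_all add: Zmod_eq)

lemma pair_sums_subset: "n > 0 \<Longrightarrow> pair_sums n k f \<subseteq> Zmod n"
  by (auto simp: pair_sums_def Zmod_eq)

lemma card_shift_preimage_le:
  assumes "n > 0" "finite Y"
  shows "card {b \<in> Zmod n. (b + c) mod int n \<in> Y} \<le> card Y"
proof (rule card_inj_on_le[where f = "\<lambda>b. (b + c) mod int n"])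
  show "inj_on (\<lambda>b. (b + c) mod int n) {b \<in> Zmod n. (b + c) mod int n \<in> Y}"
  proof (rule inj_onI)
    fix x y
    assume "x \<in> {b \<in> Zmod n. (b + c) mod int n \<in> Y}" "y \<in> {b \<in> Zmod n. (b + c) mod int n \<in> Y}"
      and eq: "(x + c) mod int n = (y + c) mod int n"
    hence "x mod int n = x" "y mod int n = y"
      by (auto simp: Zmod_eq)
    moreover have "x mod int n = y mod int n"
      using mod_diff_cong[OF eq refl, of c] by simp
    ultimately show "x = y" by metis
  qed
qed (use assms in auto)

definition sum_degree :: "nat \<Rightarrow> nat \<Rightarrow> int set \<Rightarrow> (nat \<Rightarrow> int) \<Rightarrow> nat \<Rightarrow> nat" where
  "sum_degree n k Y f v = card {u \<in> {..<k} - {v}. (f u + f v) mod int n \<in> Y}"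

lemma card_pair_sums_Int_le:
  "2 * card (pair_sums n k f \<inter> Y) \<le> (\<Sum>v<k. sum_degree n k Y f v)"
proof -
  define E where "E = {(i, j). i < j \<and> j < k \<and> (f i + f j) mod int n \<in> Y}"
  have fin: "finite E"
    unfolding E_def by (rule finite_subset[OF _ finite_ordered_pairs[of k]]) auto
  have "pair_sums n k f \<inter> Y \<subseteq> (\<lambda>(i, j). (f i + f j) mod int n) ` E"
    by (auto simp: pair_sums_def E_def)
  hence "card (pair_sums n k f \<inter> Y) \<le> card E"
    by (rule surj_card_le[OF fin])
  moreover have "(\<Sum>v<k. sum_degree n k Y f v) = 2 * card E"
  proof -
    have "(\<Sum>v<k. sum_degree n k Y f v)
        = card (SIGMA v:{..<k}. {u \<in> {..<k} - {v}. (f u + f v) mod int n \<in> Y})"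
      unfolding sum_degree_def by (subst card_SigmaI) auto
    also have "(SIGMA v:{..<k}. {u \<in> {..<k} - {v}. (f u + f v) mod int n \<in> Y}) = E \<union> prod.swap ` E"
    proof (rule Set.set_eqI)
      fix z :: "nat \<times> nat"
      obtain v u where z: "z = (v, u)" by (cases z)
      show "z \<in> (SIGMA v:{..<k}. {u \<in> {..<k} - {v}. (f u + f v) mod int n \<in> Y})
          \<longleftrightarrow> z \<in> E \<union> prod.swap ` E"
        unfolding z Un_iff pair_in_swap_image
        by (cases u v rule: linorder_cases) (auto simp: E_def add.commute)
    qed
    also have "card \<dots> = card E + card (prod.swap ` E)"
      using fin by (intro card_Un_disjoint) (auto simp: E_def)
    also have "card (prod.swap ` E) = card E"
      by (rule card_image) auto
    finally show ?thesis by simp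
  qed
  ultimately show ?thesis by simp
qed

lemma power_mean_bound:
  fixes b :: real and d :: "nat \<Rightarrow> nat"
  assumes b: "b \<ge> 1" and k: "k > 0" and le: "2 * e \<le> (\<Sum>v<k. d v)"
  shows "b ^ e \<le> (\<Sum>v<k. (b powr (real k / 2)) ^ d v) / real k"
proof -
  define c where "c = b powr (real k / 2)"
  have c: "c \<ge> 1" using b by (simp add: c_def ge_one_powr_ge_zero)
  have "b ^ e = b powr real e"
    using b by (simp add: powr_realpow)
  also have "\<dots> \<le> b powr (real (\<Sum>v<k. d v) / 2)"
    using le b by (intro powr_mono) linarith+
  also have "\<dots> = (c powr real (\<Sum>v<k. d v)) powr (1 / real k)"
    using k b by (simp add: c_def powr_powr)
  also have "c powr real (\<Sum>v<k. d v) = (\<Prod>v<k. c ^ d v)"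
    using c powr_realpow[of c "\<Sum>v<k. d v"] by (simp add: power_sum)
  also have "\<dots> powr (1 / real k) \<le> (\<Sum>v<k. c ^ d v / real k)"
    using arith_geom_mean[of "{..<k}" "\<lambda>v. c ^ d v"] k c by auto
  finally show ?thesis
    by (simp add: c_def sum_divide_distrib)
qed

lemma sum_power_sum_degree_le:
  fixes B :: real
  assumes n: "n > 0" and B: "B \<ge> 1" and v: "v < k" and Y: "finite Y"
  shows "(\<Sum>f\<in>{..<k} \<rightarrow>\<^sub>E Zmod n. B ^ sum_degree n k Y f v)
           \<le> real n ^ k * (1 + card Y * B / n) ^ k"
proof -
  define h where "h = (\<lambda>c. if c mod int n \<in> Y then B else 1)"
  let ?P = "{..<k} \<rightarrow>\<^sub>E Zmod n"
  define g where "g = (\<lambda>c u b. if u = v then (if b = c then 1 else 0) else h (b + c))"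
  have deg: "B ^ sum_degree n k Y f v = (\<Prod>u\<in>{..<k} - {v}. h (f u + f v))" for f
  proof -
    have "(\<Prod>u\<in>{..<k} - {v}. h (f u + f v))
       = (\<Prod>u\<in>{u \<in> {..<k} - {v}. (f u + f v) mod int n \<in> Y}. B)"
      unfolding h_def by (subst prod.inter_filter) auto
    thus ?thesis by (simp add: sum_degree_def)
  qed
  have "B ^ sum_degree n k Y f v = (\<Sum>c\<in>Zmod n. \<Prod>u<k. g c u (f u))" if f: "f \<in> ?P" for f
  proof -
    have "(\<Prod>u<k. g c u (f u)) = (if f v = c then \<Prod>u\<in>{..<k} - {v}. h (f u + f v) else 0)" for c
      using v by (subst prod.remove[of _ v]) (auto simp: g_def intro!: prod.cong)
    moreover have "f v \<in> Zmod n" using f v by auto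
    ultimately show ?thesis
      unfolding deg by (simp add: finite_Zmod)
  qed
  hence "(\<Sum>f\<in>?P. B ^ sum_degree n k Y f v) = (\<Sum>f\<in>?P. \<Sum>c\<in>Zmod n. \<Prod>u<k. g c u (f u))"
    by simp
  also have "\<dots> = (\<Sum>c\<in>Zmod n. \<Sum>f\<in>?P. \<Prod>u<k. g c u (f u))"
    by (rule sum.swap)
  also have "\<dots> = (\<Sum>c\<in>Zmod n. \<Prod>u<k. \<Sum>b\<in>Zmod n. g c u b)"
    by (subst prod_sum_PiE) (auto simp: finite_Zmod)
  also have "\<dots> \<le> (\<Sum>c\<in>Zmod n. (real n + card Y * B) ^ (k - 1))"
  proof (rule sum_mono)
    fix c assume c: "c \<in> Zmod n"
    have "(\<Sum>b\<in>Zmod n. h (b + c)) \<le> (\<Sum>b\<in>Zmod n. 1 + (if (b + c) mod int n \<in> Y then B else 0))"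
      using B by (intro sum_mono) (auto simp: h_def)
    also have "\<dots> = real n + card {b \<in> Zmod n. (b + c) mod int n \<in> Y} * B"
      by (simp add: sum.distrib card_Zmod flip: sum.inter_filter[OF finite_Zmod])
    also have "\<dots> \<le> real n + card Y * B"
      using card_shift_preimage_le[OF n Y, of c] B by simp
    finally have 1: "(\<Sum>b\<in>Zmod n. h (b + c)) \<le> real n + card Y * B" .
    have 0: "0 \<le> (\<Sum>b\<in>Zmod n. h (b + c))"
      using B by (intro sum_nonneg) (auto simp: h_def)
    have "(\<Prod>u<k. \<Sum>b\<in>Zmod n. g c u b) = (\<Prod>u\<in>{..<k} - {v}. \<Sum>b\<in>Zmod n. h (b + c))"
      using v c by (subst prod.remove[of _ v]) (auto simp: g_def finite_Zmod)
    also have "\<dots> = (\<Sum>b\<in>Zmod n. h (b + c)) ^ (k - 1)"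
      using v by simp
    also have "\<dots> \<le> (real n + card Y * B) ^ (k - 1)"
      by (intro power_mono 0 1)
    finally show "(\<Prod>u<k. \<Sum>b\<in>Zmod n. g c u b) \<le> (real n + card Y * B) ^ (k - 1)" .
  qed
  also have "\<dots> = real n * (real n + card Y * B) ^ (k - 1)"
    by (simp add: card_Zmod)
  also have "\<dots> \<le> (real n + card Y * B) * (real n + card Y * B) ^ (k - 1)"
    using B by (intro mult_right_mono) auto
  also have "\<dots> = (real n + card Y * B) ^ k"
    using v by (simp flip: power_Suc)
  also have "real n + card Y * B = real n * (1 + card Y * B / n)"
    using n by (simp add: field_simps)
  finally show ?thesis
    by (simp add: power_mult_distrib)
qed

lemma sum_power_card_Int_le:
  fixes b :: real
  assumes n: "n > 0" and b: "b \<ge> 1" and k: "k > 0" and Y: "finite Y"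
  shows "(\<Sum>f\<in>{..<k} \<rightarrow>\<^sub>E Zmod n. b ^ card (pair_sums n k f \<inter> Y))
           \<le> real n ^ k * (1 + card Y * b powr (real k / 2) / n) ^ k"
proof -
  let ?P = "{..<k} \<rightarrow>\<^sub>E Zmod n" and ?B = "b powr (real k / 2)"
  have B: "?B \<ge> 1" using b by (simp add: ge_one_powr_ge_zero)
  have "(\<Sum>f\<in>?P. b ^ card (pair_sums n k f \<inter> Y))
      \<le> (\<Sum>f\<in>?P. (\<Sum>v<k. ?B ^ sum_degree n k Y f v) / real k)"
    by (intro sum_mono power_mean_bound b k card_pair_sums_Int_le)
  also have "\<dots> = (\<Sum>v<k. \<Sum>f\<in>?P. ?B ^ sum_degree n k Y f v) / real k"
    by (subst sum.swap) (simp add: sum_divide_distrib)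
  also have "\<dots> \<le> (\<Sum>v<k. real n ^ k * (1 + card Y * ?B / n) ^ k) / real k"
    by (intro divide_right_mono sum_mono sum_power_sum_degree_le n B Y) auto
  finally show ?thesis using k by simp
qed

lemma card_injections_ge:
  assumes n: "n > 0"
  shows "real n ^ k * (1 - real k ^ 2 / n) \<le> card {f \<in> {..<k} \<rightarrow>\<^sub>E Zmod n. inj_on f {..<k}}"
proof (cases "k \<le> n")
  case True
  have "real n ^ k * (1 - real k ^ 2 / n) = real n ^ k * (1 + real k * (- (real k / n)))"
    by (simp add: power2_eq_square)
  also have "\<dots> \<le> real n ^ k * (1 + (- (real k / n))) ^ k"
    using True n by (intro mult_left_mono Bernoulli_inequality) (auto simp: field_simps)
  also have "\<dots> = (real n - real k) ^ k"
    using n by (simp add: field_simps flip: power_mult_distrib)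
  also have "\<dots> = (\<Prod>i\<in>{0..<k}. real n - real k)"
    by simp
  also have "\<dots> \<le> (\<Prod>i\<in>{0..<k}. real (n - i))"
    using True by (intro prod_mono) auto
  also have "\<dots> = card {f \<in> {..<k} \<rightarrow>\<^sub>E Zmod n. inj_on f {..<k}}"
    by (subst card_inj_on_subset_funcset) (auto simp: finite_Zmod card_Zmod)
  finally show ?thesis .
next
  case False
  hence "real n * 1 \<le> real k * real k" using n by (intro mult_mono) auto
  hence "1 - real k ^ 2 / n \<le> 0" using n by (simp add: field_simps power2_eq_square)
  hence "real n ^ k * (1 - real k ^ 2 / n) \<le> 0" by (intro mult_nonneg_nonpos) auto
  thus ?thesis by linarith
qed

lemma prob_random_subset_disjoint:
  assumes X: "X \<subseteq> Zmod n" and p: "0 \<le> p" "p \<le> 1"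
  shows "measure_pmf.prob (random_subset n p) {A. X \<inter> A = {}} = (1 - p) ^ card X"
proof -
  have "measure_pmf.prob (random_subset n p) {A. X \<inter> A = {}}
      = measure_pmf.prob (Pi_pmf (Zmod n) False (\<lambda>_. bernoulli_pmf p))
          (Pi (Zmod n) (\<lambda>x. if x \<in> X then {False} else UNIV))"
    unfolding random_subset_def measure_map_pmf
    by (rule arg_cong[where f = "measure_pmf.prob _"]) (use X in \<open>auto simp: Pi_def\<close>)
  also have "\<dots> = (\<Prod>x\<in>Zmod n. measure_pmf.prob (bernoulli_pmf p) (if x \<in> X then {False} else UNIV))"
    by (rule measure_Pi_pmf_Pi) (rule finite_Zmod)
  also have "\<dots> = (\<Prod>x\<in>Zmod n. if x \<in> X then 1 - p else 1)"
    using p by (intro prod.cong) (auto simp: measure_pmf_single)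
  also have "\<dots> = (\<Prod>x\<in>X. 1 - p)"
    using X by (subst prod.inter_restrict[OF finite_Zmod, symmetric]) (simp add: Int_absorb1)
  finally show ?thesis by simp
qed

lemma finite_set_random_subset: "finite (set_pmf (random_subset n p))"
  by (rule finite_subset[of _ "Pow (Zmod n)"]) (auto simp: random_subset_def finite_Zmod)

lemma independence_number_ge:
  assumes f: "f \<in> {..<k} \<rightarrow> Zmod n" "inj_on f {..<k}" and disj: "pair_sums n k f \<inter> A = {}"
  shows "k \<le> independence_number (cayley_sum_graph n A)"
proof -
  have notin: "(f i + f j) mod int n \<notin> A" if "i < k" "j < k" "i \<noteq> j" for i j
  proof -
    have "(f i + f j) mod int n \<in> pair_sums n k f"
    proof (cases "i < j")
      case True
      thus ?thesis using that by (force simp: pair_sums_def)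
    next
      case False
      thus ?thesis using that
        by (auto simp: pair_sums_def add.commute intro!: image_eqI[of _ _ "(j, i)"])
    qed
    thus ?thesis using disj by auto
  qed
  have "indep (f ` {..<k}) (snd (cayley_sum_graph n A))"
    using notin
    by (auto simp: indep_def cayley_sum_graph_def residue_ring_def doubleton_eq_iff add.commute)
  hence "f ` {..<k} \<in> {S. S \<subseteq> fst (cayley_sum_graph n A) \<and> indep S (snd (cayley_sum_graph n A))}"
    using f by (auto simp: cayley_sum_graph_def)
  moreover have "finite {S. S \<subseteq> fst (cayley_sum_graph n A) \<and> indep S (snd (cayley_sum_graph n A))}"
    by (rule finite_subset[of _ "Pow (Zmod n)"]) (auto simp: cayley_sum_graph_def finite_Zmod)
  ultimately have "card (f ` {..<k}) \<le> independence_number (cayley_sum_graph n A)"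
    unfolding independence_number_def by (intro Max_ge) auto
  thus ?thesis using f by (simp add: card_image)
qed

lemma (in prob_space) prob_eq_0_le:
  assumes "random_variable borel f" "integrable M (\<lambda>x. (f x)\<^sup>2)" "expectation f > 0"
  shows "prob {x \<in> space M. f x = 0} \<le> expectation (\<lambda>x. (f x)\<^sup>2) / (expectation f)\<^sup>2 - 1"
proof -
  have "prob {x \<in> space M. f x = 0} \<le> prob {x \<in> space M. \<bar>f x - expectation f\<bar> \<ge> expectation f}"
    using assms by (intro finite_measure_mono) auto
  also have "\<dots> \<le> variance f / (expectation f)\<^sup>2"
    by (rule Chebyshev_inequality) (use assms in auto)
  also have "variance f = expectation (\<lambda>x. (f x)\<^sup>2) - (expectation f)\<^sup>2"
    by (rule variance_eq[OF square_integrable_imp_integrable[OF assms(1,2)] assms(2)])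
  finally show ?thesis
    using assms by (simp add: diff_divide_distrib)
qed

lemma prob_independence_number_ge:
  fixes p :: real
  assumes n: "n > 0" and k: "k > 0" and p: "0 \<le> p" "p < 1" and kn: "real k ^ 2 < n"
  shows "measure_pmf.prob (random_subset n p) {A. k \<le> independence_number (cayley_sum_graph n A)}
     \<ge> 2 - (1 + real k ^ 2 * (1 / (1 - p)) powr (real k / 2) / n) ^ k / (1 - real k ^ 2 / n) ^ 2"
proof -
  define b where "b = 1 / (1 - p)"
  have b: "b \<ge> 1" "b > 0" using p by (auto simp: b_def)
  have b_inv: "1 - p = 1 / b" by (simp add: b_def)
  let ?P = "{..<k} \<rightarrow>\<^sub>E Zmod n"
  define I where "I = {f \<in> ?P. inj_on f {..<k}}"
  define K where "K = (1 + real k ^ 2 * b powr (real k / 2) / n) ^ k"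
  let ?M = "measure_pmf (random_subset n p)"
  let ?X = "pair_sums n k"
  define ind where "ind = (\<lambda>X. indicator {A. X \<inter> A = {}} :: int set \<Rightarrow> real)"
  define W where "W = (\<lambda>A. \<Sum>f\<in>I. b ^ card (?X f) * ind (?X f) A)"
  have finP: "finite ?P" by (intro finite_PiE) (auto simp: finite_Zmod)
  have int [simp]: "integrable ?M h" for h :: "int set \<Rightarrow> real"
    by (intro integrable_measure_pmf_finite finite_set_random_subset)
  have ind: "measure_pmf.expectation (random_subset n p) (ind X) = (1 / b) ^ card X" if "X \<subseteq> Zmod n" for X
    using prob_random_subset_disjoint[OF that, of p] p by (simp add: b_inv ind_def)
  have EW: "measure_pmf.expectation (random_subset n p) W = card I"
  proof -
    have "measure_pmf.expectation (random_subset n p) W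
        = (\<Sum>f\<in>I. b ^ card (?X f) * measure_pmf.expectation (random_subset n p) (ind (?X f)))"
      unfolding W_def by (subst Bochner_Integration.integral_sum) simp_all
    also have "\<dots> = (\<Sum>f\<in>I. 1)"
      using n b by (intro sum.cong refl) (simp add: ind pair_sums_subset flip: power_mult_distrib)
    finally show ?thesis by simp
  qed
  have EW2: "measure_pmf.expectation (random_subset n p) (\<lambda>A. (W A)\<^sup>2) \<le> (real n ^ k)\<^sup>2 * K"
  proof -
    have "(W A)\<^sup>2 = (\<Sum>g\<in>I. \<Sum>f\<in>I. b ^ (card (?X g) + card (?X f)) * ind (?X g \<union> ?X f) A)" for A
      unfolding W_def power2_eq_square sum_product
      by (intro sum.cong refl) (auto simp: ind_def indicator_def power_add)
    hence "measure_pmf.expectation (random_subset n p) (\<lambda>A. (W A)\<^sup>2)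
        = (\<Sum>g\<in>I. \<Sum>f\<in>I. b ^ (card (?X g) + card (?X f)) * measure_pmf.expectation (random_subset n p) (ind (?X g \<union> ?X f)))"
      by (simp add: Bochner_Integration.integral_sum)
    also have "\<dots> = (\<Sum>g\<in>I. \<Sum>f\<in>I. b ^ card (?X f \<inter> ?X g))"
    proof (intro sum.cong refl)
      fix f g
      have "card (?X g) + card (?X f) = card (?X g \<union> ?X f) + card (?X f \<inter> ?X g)"
        using card_Un_Int[OF finite_pair_sums finite_pair_sums] by (simp add: Int_commute)
      thus "b ^ (card (?X g) + card (?X f)) * measure_pmf.expectation (random_subset n p) (ind (?X g \<union> ?X f))
          = b ^ card (?X f \<inter> ?X g)"
        using n b by (simp add: ind pair_sums_subset power_add power_one_over)
    qed
    also have "\<dots> \<le> (\<Sum>g\<in>I. \<Sum>f\<in>?P. b ^ card (?X f \<inter> ?X g))"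
      using b by (intro sum_mono sum_mono2 finP) (auto simp: I_def)
    also have "\<dots> \<le> (\<Sum>g\<in>?P. \<Sum>f\<in>?P. b ^ card (?X f \<inter> ?X g))"
      using b by (intro sum_mono2 finP sum_nonneg) (auto simp: I_def)
    also have "\<dots> \<le> (\<Sum>g\<in>?P. real n ^ k * K)"
    proof (rule sum_mono)
      fix g
      have "(\<Sum>f\<in>?P. b ^ card (?X f \<inter> ?X g))
          \<le> real n ^ k * (1 + card (?X g) * b powr (real k / 2) / n) ^ k"
        by (intro sum_power_card_Int_le n b k finite_pair_sums)
      also have "\<dots> \<le> real n ^ k * K"
        unfolding K_def using card_pair_sums_le[of n k g, THEN of_nat_mono[where 'a = real]] n
        by (intro mult_left_mono power_mono add_left_mono divide_right_mono mult_right_mono) auto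
      finally show "(\<Sum>f\<in>?P. b ^ card (?X f \<inter> ?X g)) \<le> real n ^ k * K" .
    qed
    also have "\<dots> = (real n ^ k)\<^sup>2 * K"
      by (simp add: card_PiE card_Zmod power2_eq_square)
    finally show ?thesis .
  qed
  have cardI: "card I \<ge> real n ^ k * (1 - real k ^ 2 / n)"
    unfolding I_def by (rule card_injections_ge[OF n])
  have pos: "real n ^ k * (1 - real k ^ 2 / n) > 0"
    using n kn by (intro mult_pos_pos) auto
  have K: "K \<ge> 0" unfolding K_def by simp
  have "measure_pmf.prob (random_subset n p) {A. W A = 0}
      \<le> measure_pmf.expectation (random_subset n p) (\<lambda>A. (W A)\<^sup>2) / (real (card I))\<^sup>2 - 1"
    using measure_pmf.prob_eq_0_le[of W "random_subset n p"] pos cardI by (simp add: EW)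
  also have "\<dots> \<le> ((real n ^ k)\<^sup>2 * K) / (real n ^ k * (1 - real k ^ 2 / n))\<^sup>2 - 1"
    using EW2 cardI pos K n by (intro diff_right_mono frac_le power_mono) auto
  also have "((real n ^ k)\<^sup>2 * K) / (real n ^ k * (1 - real k ^ 2 / n))\<^sup>2 = K / (1 - real k ^ 2 / n)\<^sup>2"
    using n by (simp add: power_mult_distrib)
  finally have W0: "measure_pmf.prob (random_subset n p) {A. W A = 0} \<le> K / (1 - real k ^ 2 / n)\<^sup>2 - 1" .
  have "- {A. W A = 0} \<subseteq> {A. k \<le> independence_number (cayley_sum_graph n A)}"
  proof safe
    fix A assume "W A \<noteq> 0"
    then obtain f where f: "f \<in> I" "ind (?X f) A \<noteq> 0"
      unfolding W_def by (metis (no_types, lifting) mult_zero_right sum.neutral)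
    thus "k \<le> independence_number (cayley_sum_graph n A)"
      by (intro independence_number_ge[of f]) (auto simp: I_def ind_def indicator_def split: if_splits)
  qed
  hence "measure_pmf.prob (random_subset n p) (- {A. W A = 0})
      \<le> measure_pmf.prob (random_subset n p) {A. k \<le> independence_number (cayley_sum_graph n A)}"
    by (intro measure_pmf.finite_measure_mono) auto
  moreover have "measure_pmf.prob (random_subset n p) (- {A. W A = 0}) = 1 - measure_pmf.prob (random_subset n p) {A. W A = 0}"
    using measure_pmf.prob_compl[of "{A. W A = 0}" "random_subset n p"] by (simp add: Compl_eq_Diff_UNIV)
  ultimately show ?thesis
    using W0 unfolding K_def b_def by linarith
qed

text \<open>
  Since \<open>k\<close> is at most \<open>3 * n powr e * ln n\<close>, the summand \<open>6 * e\<close> of \<open>d\<close> absorbs the power of \<open>n\<close> in \<open>k ^ 3\<close>,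
  and \<open>2 / sqrt (ln n)\<close> tends to \<open>0\<close> slowly enough to beat the remaining power of \<open>ln n\<close>.
\<close>

lemma tuple_size_bounds:
  fixes p e d L :: real and n k :: nat
  assumes n: "n \<ge> 2" and p: "p \<le> 1 / 2" "real n powr (- e) \<le> p" and e: "e \<ge> 0"
    and d: "d = 6 * e + 2 / sqrt (ln n)" "d \<le> 1"
  defines "b \<equiv> 1 / (1 - p)"
  defines "L \<equiv> log b n"
  defines "k \<equiv> nat \<lceil>(2 - d) * L\<rceil>"
  shows "k > 0" "real k ^ 3 * b powr (real k / 2) / n \<le> 54 * ln n ^ 3 * exp (- sqrt (ln n))"
proof -
  have ln_n: "ln (real n) > 0" using n by simp
  have "real n powr (- e) > 0" using n by simp
  hence p0: "p > 0" using p(2) by linarith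
  have b: "b > 1" "b \<le> 2" using p(1) p0 by (auto simp: b_def field_simps)
  have d0: "d \<ge> 0" using d(1) e ln_n by simp
  have "ln (1 - p) \<le> - p"
    using ln_le_minus_one[of "1 - p"] p by simp
  hence ln_b: "ln b \<ge> p" using p by (simp add: b_def ln_div)
  have L: "L = ln n / ln b" by (simp add: L_def log_def)
  have L1: "L \<ge> 1"
    using b n by (simp add: L_def le_log_iff)
  have "1 / p \<le> n powr e"
    using p p0 n by (simp add: powr_minus field_simps)
  hence "ln n * (1 / p) \<le> ln n * n powr e"
    using ln_n by (intro mult_left_mono) auto
  moreover have "L \<le> ln n / p"
    unfolding L using ln_b ln_n p0 by (intro divide_left_mono) auto
  ultimately have L_le: "L \<le> ln n * n powr e" by simp
  have dL: "1 * 1 \<le> (2 - d) * L"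
    using L1 d by (intro mult_mono) auto
  show k: "k > 0" using dL by (simp add: k_def)
  have "real k = of_int \<lceil>(2 - d) * L\<rceil>"
    using dL by (simp add: k_def)
  hence k_le: "real k \<le> (2 - d) * L + 1"
    by linarith
  have "(2 - d) * L \<le> 2 * L" using d0 L1 by (intro mult_right_mono) auto
  hence k_le': "real k \<le> 3 * (ln n * n powr e)"
    using k_le L1 L_le by linarith
  have "b powr (real k / 2) \<le> b powr (L * (1 - d / 2) + 1 / 2)"
    using k_le b by (intro powr_mono) (auto simp: field_simps)
  also have "\<dots> = (b powr L) powr (1 - d / 2) * b powr (1 / 2)"
    by (simp add: powr_add powr_powr)
  also have "b powr L = n" using b n by (simp add: L_def)
  also have "b powr (1 / 2) \<le> b powr 1" using b by (intro powr_mono) auto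
  also have "b powr 1 \<le> 2" using b by simp
  finally have pow_le: "b powr (real k / 2) \<le> n powr (1 - d / 2) * 2"
    by (simp add: mult_left_mono)
  have "real k ^ 3 * b powr (real k / 2) / n \<le> (3 * (ln n * n powr e)) ^ 3 * (n powr (1 - d / 2) * 2) / n"
    using k_le' pow_le by (intro divide_right_mono mult_mono power_mono) auto
  also have "\<dots> = 54 * ln n ^ 3 * ((n powr e) ^ 3 * n powr (1 - d / 2) / n)"
    by (simp add: power_mult_distrib)
  also have "(n powr e) ^ 3 = n powr (3 * e)"
    using n by (simp add: powr_power)
  also have "n powr (3 * e) * n powr (1 - d / 2) / n = n powr (3 * e - d / 2)"
    using n powr_add[of "real n" "3 * e - d / 2" 1] by (simp add: field_simps flip: powr_add)
  also have "3 * e - d / 2 = - (1 / sqrt (ln n))"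
    using d(1) by (simp add: add_divide_distrib)
  also have "n powr (- (1 / sqrt (ln n))) = exp (- (ln n / sqrt (ln n)))"
    using n by (simp add: powr_def)
  also have "ln n / sqrt (ln n) = sqrt (ln n)"
    using ln_n by (simp add: real_div_sqrt)
  finally show "real k ^ 3 * b powr (real k / 2) / n \<le> 54 * ln n ^ 3 * exp (- sqrt (ln n))" .
qed

lemma prob_independence_number_ge_exp:
  fixes p T :: real
  assumes n: "n > 0" and k: "k > 0" and p: "0 \<le> p" "p < 1"
    and T: "real k ^ 3 * (1 / (1 - p)) powr (real k / 2) / n \<le> T" "T < 1"
  shows "measure_pmf.prob (random_subset n p) {A. k \<le> independence_number (cayley_sum_graph n A)}
     \<ge> 2 - exp T / (1 - T) ^ 2"
proof -
  define B where "B = (1 / (1 - p)) powr (real k / 2)"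
  have B: "B \<ge> 1" unfolding B_def using p by (intro ge_one_powr_ge_zero) auto
  have "real k ^ 2 * 1 \<le> real k ^ 2 * (real k * B)"
    using mult_mono[of 1 "real k" 1 B] k B by (intro mult_left_mono) auto
  hence "real k ^ 2 / n \<le> real k ^ 3 * B / n"
    using n by (intro divide_right_mono) (auto simp: power3_eq_cube power2_eq_square)
  hence kT: "real k ^ 2 / n \<le> T" using T(1) unfolding B_def by linarith
  hence kn: "real k ^ 2 < n" using le_less_trans[OF kT T(2)] n by simp
  have "(1 + real k ^ 2 * B / n) ^ k \<le> exp (real k ^ 2 * B / n) ^ k"
    using B by (intro power_mono exp_ge_add_one_self) auto
  also have "\<dots> = exp (real k ^ 3 * B / n)"
    by (simp add: power3_eq_cube power2_eq_square mult.assoc flip: exp_of_nat_mult)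
  also have "\<dots> \<le> exp T" using T(1) by (simp add: B_def)
  finally have "(1 + real k ^ 2 * B / n) ^ k \<le> exp T" .
  hence "(1 + real k ^ 2 * B / n) ^ k / (1 - real k ^ 2 / n) ^ 2 \<le> exp T / (1 - T) ^ 2"
    using kT T(2) by (intro frac_le power_mono) auto
  thus ?thesis
    using prob_independence_number_ge[OF n k p kn] unfolding B_def by linarith
qed

theorem theorem9p1:
  fixes p \<epsilon> :: "nat \<Rightarrow> real"
  assumes p_upper: "\<And>n. prime n \<Longrightarrow> p n \<le> 1 / 2"
    and p_lower: "\<And>n. prime n \<Longrightarrow> real n powr (- \<epsilon> n) \<le> p n"
    and \<epsilon>_small: "(\<epsilon> \<longlongrightarrow> 0) primes_at_top"
  shows "\<exists>\<delta> :: nat \<Rightarrow> real. (\<delta> \<longlongrightarrow> 0) primes_at_top \<and>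
    ((\<lambda>n. measure_pmf.prob (random_subset n (p n))
        {A. real (independence_number (cayley_sum_graph n A))
              \<ge> (2 + \<delta> n) * log (1 / (1 - p n)) (real n)})
      \<longlongrightarrow> 1) primes_at_top"
proof -
  define d where "d = (\<lambda>n. 6 * \<bar>\<epsilon> n\<bar> + 2 / sqrt (ln (real n)))"
  define T where "T = (\<lambda>n. 54 * ln (real n) ^ 3 * exp (- sqrt (ln (real n))))"
  let ?L = "\<lambda>n. log (1 / (1 - p n)) (real n)"
  let ?prob = "\<lambda>n. measure_pmf.prob (random_subset n (p n))
        {A. real (independence_number (cayley_sum_graph n A)) \<ge> (2 + - d n) * ?L n}"
  have le: "primes_at_top \<le> at_top"
    by (simp add: primes_at_top_def)
  have "((\<lambda>n. 2 / sqrt (ln (real n))) \<longlongrightarrow> 0) at_top"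
    by real_asymp
  hence "((\<lambda>n. 2 / sqrt (ln (real n))) \<longlongrightarrow> 0) primes_at_top"
    by (rule tendsto_mono[OF le])
  moreover have "((\<lambda>n. 6 * \<bar>\<epsilon> n\<bar>) \<longlongrightarrow> 0) primes_at_top"
    using \<epsilon>_small by (auto intro!: tendsto_eq_intros)
  ultimately have d0: "(d \<longlongrightarrow> 0) primes_at_top"
    unfolding d_def using tendsto_add by fastforce
  have "(T \<longlongrightarrow> 0) at_top"
    unfolding T_def by real_asymp
  hence T0: "(T \<longlongrightarrow> 0) primes_at_top"
    by (rule tendsto_mono[OF le])
  have "eventually prime primes_at_top"
    by (simp add: primes_at_top_def eventually_inf_principal)
  moreover have "eventually (\<lambda>n. d n < 1) primes_at_top" "eventually (\<lambda>n. T n < 1) primes_at_top"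
    using d0 T0 by (auto intro: order_tendstoD(2))
  ultimately have lower: "eventually (\<lambda>n. 2 - exp (T n) / (1 - T n) ^ 2 \<le> ?prob n) primes_at_top"
  proof eventually_elim
    case (elim n)
    define k where "k = nat \<lceil>(2 - d n) * ?L n\<rceil>"
    have n: "n \<ge> 2" using elim(1) by (rule prime_ge_2_nat)
    have "real n powr (- \<bar>\<epsilon> n\<bar>) \<le> real n powr (- \<epsilon> n)"
      using n by (intro powr_mono) auto
    hence p_lower': "real n powr (- \<bar>\<epsilon> n\<bar>) \<le> p n"
      using p_lower[OF elim(1)] by linarith
    hence p0: "p n \<ge> 0" by (rule order.trans[OF powr_ge_zero])
    have k: "k > 0" "real k ^ 3 * (1 / (1 - p n)) powr (real k / 2) / n \<le> T n"
      using tuple_size_bounds[OF n p_upper[OF elim(1)] p_lower', of "d n"] elim(2)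
      by (simp_all add: k_def T_def d_def)
    have "2 - exp (T n) / (1 - T n) ^ 2
        \<le> measure_pmf.prob (random_subset n (p n)) {A. k \<le> independence_number (cayley_sum_graph n A)}"
      using n p0 p_upper[OF elim(1)] elim(3) by (intro prob_independence_number_ge_exp k) auto
    also have "\<dots> \<le> ?prob n"
      using real_nat_ceiling_ge[of "(2 - d n) * ?L n"]
      by (intro measure_pmf.finite_measure_mono) (auto simp: k_def)
    finally show ?case .
  qed
  have lim: "((\<lambda>n. 2 - exp (T n) / (1 - T n) ^ 2) \<longlongrightarrow> 1) primes_at_top"
    using T0 by (auto intro!: tendsto_eq_intros)
  have "(?prob \<longlongrightarrow> 1) primes_at_top"
    by (rule tendsto_sandwich[OF lower _ lim tendsto_const]) simp
  moreover have "((\<lambda>n. - d n) \<longlongrightarrow> 0) primes_at_top"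
    using tendsto_minus[OF d0] by simp
  ultimately show ?thesis
    by (intro exI[of _ "\<lambda>n. - d n"] conjI)
qed

end
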